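(* Let $G\subsetneq\mathbb{R}^n$ be any domain, $x\in G$ and $0<t<1$. Then $$B_j(x,\log(1+2t))\subseteq B_s(x,t)\subseteq B_j\left(x,\log\frac{1+t}{1-t}\right),$$ where the latter inclusion is sharp for all possible choices of the domain $G$. Moreover, if $G$ is convex, the former inclusion can be replaced with $$B_j\left(x,\max\left\{\log\left(\frac{t+\sqrt{2}}{\sqrt{2}-t}\right),\log(1+2t)\right\}\right)\subseteq B_s(x,t).$$
   Context: For a domain $G\subsetneq\mathbb{R}^n$ and $x\in G$, $d_G(x)=\inf\{|x-z| : z\in\partial G\}$. The triangular ratio metric is $s_G(x,y)=\dfrac{|x-y|}{\inf_{z\in\partial G}(|x-z|+|z-y|)}$ and the distance ratio metric is $j_G(x,y)=\log\left(1+\dfrac{|x-y|}{\min\{d_G(x),d_G(y)\}}\right)$, for $x,y\in G$. The corresponding balls are $B_s(x,r)=\{y\in G : s_G(x,y)<r\}$ and $B_j(x,r)=\{y\in G : j_G(x,y)<r\}$. "Sharp" means that the radius of the containing ball $B_j(x,\cdot)$ cannot be replaced by any smaller number (for any given $G$, $x$, $t$). *)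

theory Defs
  imports "HOL-Analysis.Analysis"
begin

text \<open>
  For a proper domain G, i.e. a nonempty open connected set other than the whole space, the
  boundary \<^term>\<open>frontier G\<close> is nonempty. Hence the infima below range over nonempty sets of
  nonnegative reals, and the value 0 that \<^const>\<open>infdist\<close> has by convention on the empty set
  does not occur.
\<close>

definition bdry_dist :: "(real ^ 'n) set \<Rightarrow> real ^ 'n \<Rightarrow> real" where
  "bdry_dist G x = infdist x (frontier G)"

definition triangular_ratio_metric :: "(real ^ 'n) set \<Rightarrow> real ^ 'n \<Rightarrow> real ^ 'n \<Rightarrow> real" where
  "triangular_ratio_metric G x y = dist x y / (INF z\<in>frontier G. dist x z + dist z y)"

definition distance_ratio_metric :: "(real ^ 'n) set \<Rightarrow> real ^ 'n \<Rightarrow> real ^ 'n \<Rightarrow> real" where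
  "distance_ratio_metric G x y = ln (1 + dist x y / min (bdry_dist G x) (bdry_dist G y))"

definition s_ball :: "(real ^ 'n) set \<Rightarrow> real ^ 'n \<Rightarrow> real \<Rightarrow> (real ^ 'n) set" where
  "s_ball G x r = {y \<in> G. triangular_ratio_metric G x y < r}"

definition j_ball :: "(real ^ 'n) set \<Rightarrow> real ^ 'n \<Rightarrow> real \<Rightarrow> (real ^ 'n) set" where
  "j_ball G x r = {y \<in> G. distance_ratio_metric G x y < r}"

end

theory Submission
  imports Defs
begin

text \<open>
  Write \<open>d = |x - y|\<close>, let \<open>m\<close> be the smaller of the distances of \<open>x\<close> and \<open>y\<close> to the boundary
  of \<open>G\<close>, and let \<open>L\<close> be the infimum of \<open>|x - z| + |z - y|\<close> over boundary points \<open>z\<close>. Then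
  \<open>s = d / L\<close> and \<open>j = log (1 + d / m)\<close>, so an inclusion between the two kinds of balls amounts
  to a bound on \<open>L\<close> in terms of \<open>d\<close> and \<open>m\<close>.

  \<^item> Each of \<open>|x - z|\<close>, \<open>|z - y|\<close> is at least \<open>m\<close>, so \<open>L \<ge> 2 m\<close>. This gives the inner inclusion.
  \<^item> The detour through a boundary point nearest to \<open>x\<close> or to \<open>y\<close> shows \<open>L \<le> d + 2 m\<close>, that is
    \<open>s \<ge> d / (d + 2 m)\<close>, and this quotient is less than \<open>t\<close> exactly when \<open>d / m < 2 t / (1 - t)\<close>.
    This gives the outer inclusion.
  \<^item> The bound \<open>L \<le> d + 2 m\<close> is an equality when \<open>y\<close> lies on the segment from \<open>x\<close> to a nearest boundary
    point. If \<open>y\<close> has covered the fraction \<open>k\<close> of that segment, then \<open>s = k / (2 - k)\<close> and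
    \<open>j = - log (1 - k)\<close>, and letting \<open>k\<close> increase to \<open>2 t / (1 + t)\<close> shows that the outer radius
    is optimal. Every boundary has nearest points, hence sharpness in every \<open>G\<close>.
  \<^item> If \<open>G\<close> is convex, each boundary point \<open>z\<close> has a supporting hyperplane, from which \<open>x\<close> and \<open>y\<close>
    are at distance at least \<open>m\<close>. Reflecting \<open>y\<close> in that hyperplane straightens the broken line
    from \<open>x\<close> through \<open>z\<close> to \<open>y\<close>, so that
    \<open>(|x - z| + |z - y|)\<^sup>2 \<ge> d\<^sup>2 + 4 m\<^sup>2 \<ge> (d + 2 m)\<^sup>2 / 2\<close>.
    Thus \<open>L \<ge> (d + 2 m) / sqrt 2\<close>, which is the bound behind the improved inner radius.
\<close>

section \<open>Distance to the boundary and broken lines through it\<close>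

lemma frontier_nonempty:
  fixes G :: "'a::real_normed_vector set"
  assumes "x \<in> G" "G \<noteq> UNIV"
  shows "frontier G \<noteq> {}"
  using assms frontier_eq_empty[of G] by auto

lemma infdist_frontier_pos:
  fixes G :: "'a::euclidean_space set"
  assumes "open G" "G \<noteq> UNIV" "x \<in> G"
  shows "0 < infdist x (frontier G)"
proof -
  have "x \<notin> frontier G"
    using assms by (simp add: frontier_def interior_open)
  then show ?thesis
    using frontier_nonempty[OF assms(3,2)] infdist_pos_not_in_closed[OF frontier_closed] by blast
qed

text \<open>
  The ball meets \<open>G\<close> in its centre; being connected, it could only leave \<open>G\<close> by crossing the
  boundary, which is too far away.
\<close>

lemma ball_infdist_frontier_subset:
  fixes G :: "'a::euclidean_space set"
  assumes "x \<in> G"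
  shows "ball x (infdist x (frontier G)) \<subseteq> G"
proof (rule ccontr)
  let ?B = "ball x (infdist x (frontier G))"
  assume "\<not> ?B \<subseteq> G"
  then have ne: "?B - G \<noteq> {}"
    by blast
  then have "x \<in> ?B"
    by (auto simp: infdist_nonneg intro: le_less_trans[OF zero_le_dist])
  with assms have "?B \<inter> G \<noteq> {}"
    by blast
  with ne have "?B \<inter> frontier G \<noteq> {}"
    by (intro connected_Int_frontier convex_connected convex_ball)
  then obtain z where "z \<in> frontier G" "dist x z < infdist x (frontier G)"
    by auto
  then show False
    using infdist_le[of z "frontier G" x] by linarith
qed

lemma bdd_below_broken_lines: "bdd_below ((\<lambda>z. dist x z + dist z y) ` S)"
  by (rule bdd_belowI[of _ 0]) auto

lemma INF_broken_lines_ge: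
  assumes "S \<noteq> {}"
  shows "infdist x S + infdist y S \<le> (INF z\<in>S. dist x z + dist z y)"
proof (rule cINF_greatest[OF assms])
  fix z assume "z \<in> S"
  then show "infdist x S + infdist y S \<le> dist x z + dist z y"
    using infdist_le[of z S x] infdist_le[of z S y] by (simp add: dist_commute)
qed

text \<open>
  The broken line through a point of \<open>S\<close> nearest to one endpoint is, by the triangle inequality,
  no longer than going there and back before walking straight to the other endpoint.
\<close>

lemma INF_broken_lines_le:
  fixes S :: "'a::euclidean_space set"
  assumes "closed S" "S \<noteq> {}"
  shows "(INF z\<in>S. dist x z + dist z y) \<le> dist x y + 2 * min (infdist x S) (infdist y S)"
proof -
  have near: "(INF z\<in>S. dist x z + dist z y) \<le> dist x z + dist z y" if "z \<in> S" for z
    using bdd_below_broken_lines that by (rule cINF_lower)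
  obtain z where z: "z \<in> S" "infdist x S = dist x z"
    using infdist_attains_inf[OF assms] by blast
  obtain w where w: "w \<in> S" "infdist y S = dist y w"
    using infdist_attains_inf[OF assms] by blast
  have "dist z y \<le> dist x z + dist x y" "dist x w \<le> dist x y + dist y w"
    by (metis dist_commute dist_triangle, rule dist_triangle)
  then show ?thesis
    using near[OF z(1)] near[OF w(1)] z(2) w(2) by (simp add: min_def dist_commute)
qed

section \<open>Supporting hyperplanes and reflection in them\<close>

lemma unit_normal_supporting:
  fixes G :: "'a::euclidean_space set"
  assumes "convex G" "z \<notin> G" "G \<noteq> {}"
  obtains n where "norm n = 1" "\<And>w. w \<in> G \<Longrightarrow> n \<bullet> w \<le> n \<bullet> z"
proof -
  obtain a b where a: "a \<noteq> 0" "\<forall>w\<in>G. a \<bullet> w \<le> b" "\<forall>w\<in>{z}. b \<le> a \<bullet> w"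
    using separating_hyperplane_sets[of G "{z}"] assms by auto
  have "sgn a \<bullet> w \<le> sgn a \<bullet> z" if "w \<in> G" for w
  proof -
    have "a \<bullet> w \<le> a \<bullet> z"
      using a that by force
    then show ?thesis
      by (simp add: sgn_div_norm mult_left_mono)
  qed
  then show thesis
    using that[of "sgn a"] a(1) by (simp add: norm_sgn)
qed

text \<open>
  Walking from \<open>w\<close> in the direction of the outer normal, one stays inside \<open>G\<close> for a length of at
  least the distance to the boundary, and one cannot pass the hyperplane while inside \<open>G\<close>.
\<close>

lemma infdist_frontier_le_supporting:
  fixes G :: "'a::euclidean_space set"
  assumes "norm n = 1" and supp: "\<And>w. w \<in> G \<Longrightarrow> n \<bullet> w \<le> c" and "w \<in> G"
  shows "infdist w (frontier G) \<le> c - n \<bullet> w"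
proof (rule dense_le)
  fix s assume s: "s < infdist w (frontier G)"
  show "s \<le> c - n \<bullet> w"
  proof (cases "0 \<le> s")
    case True
    then have "w + s *\<^sub>R n \<in> G"
      using s ball_infdist_frontier_subset[OF assms(3)] assms(1) by (auto simp: dist_norm)
    from supp[OF this] show ?thesis
      using assms(1) by (simp add: inner_add_right flip: power2_norm_eq_inner)
  next
    case False
    then show ?thesis
      using supp[OF assms(3)] by simp
  qed
qed

text \<open>
  Heron's reflection argument: \<open>v'\<close> below is the mirror image of \<open>v\<close> in the hyperplane through the
  origin with normal \<open>n\<close>. It has the norm of \<open>v\<close>, and \<open>u - v'\<close> is the straightened broken line.
\<close>

lemma broken_line_reflection:
  fixes u v n :: "'a::real_inner"
  assumes "norm n = 1"
  shows "(norm (u - v))\<^sup>2 + 4 * (n \<bullet> u) * (n \<bullet> v) \<le> (norm u + norm v)\<^sup>2"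
proof -
  define v' where "v' = v - (2 * (n \<bullet> v)) *\<^sub>R n"
  have nn: "n \<bullet> n = 1"
    using assms by (simp flip: power2_norm_eq_inner)
  have "(norm v')\<^sup>2 = (norm v)\<^sup>2"
    unfolding power2_norm_eq_inner v'_def
    by (simp add: nn inner_commute algebra_simps)
  then have "norm v' = norm v"
    by simp
  then have "(norm (u - v'))\<^sup>2 \<le> (norm u + norm v)\<^sup>2"
    using norm_triangle_ineq4[of u v'] by (intro power_mono) auto
  moreover have "(norm (u - v'))\<^sup>2 = (norm (u - v))\<^sup>2 + 4 * (n \<bullet> u) * (n \<bullet> v)"
    unfolding power2_norm_eq_inner v'_def
    by (simp add: nn inner_commute algebra_simps)
  ultimately show ?thesis
    by simp
qed

lemma convex_INF_broken_lines_ge: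
  fixes G :: "'a::euclidean_space set"
  assumes "open G" "convex G" "G \<noteq> UNIV" "x \<in> G" "y \<in> G"
  defines "m \<equiv> min (infdist x (frontier G)) (infdist y (frontier G))"
  shows "(dist x y + 2 * m) / sqrt 2 \<le> (INF z\<in>frontier G. dist x z + dist z y)"
proof (rule cINF_greatest[OF frontier_nonempty[OF assms(4,3)]])
  fix z assume "z \<in> frontier G"
  then have "z \<notin> G"
    using assms(1) by (simp add: frontier_def interior_open)
  then obtain n where n: "norm n = 1" "\<And>w. w \<in> G \<Longrightarrow> n \<bullet> w \<le> n \<bullet> z"
    using unit_normal_supporting[OF assms(2)] assms(4) by blast
  have m: "0 \<le> m" "m \<le> n \<bullet> (z - x)" "m \<le> n \<bullet> (z - y)"
    using infdist_frontier_le_supporting[OF n assms(4)]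
      infdist_frontier_le_supporting[OF n assms(5)] infdist_nonneg
    by (auto simp: m_def inner_diff_right)
  have "(dist x y + 2 * m)\<^sup>2 / 2 \<le> (dist x y)\<^sup>2 + 4 * m * m"
    using zero_le_power2[of "dist x y - 2 * m"] by (simp add: power2_eq_square algebra_simps)
  also have "\<dots> \<le> (dist x y)\<^sup>2 + 4 * (n \<bullet> (z - x)) * (n \<bullet> (z - y))"
    using mult_mono[OF m(2,3)] m by simp
  also have "\<dots> = (norm ((z - x) - (z - y)))\<^sup>2 + 4 * (n \<bullet> (z - x)) * (n \<bullet> (z - y))"
    by (simp add: dist_norm norm_minus_commute)
  also have "\<dots> \<le> (norm (z - x) + norm (z - y))\<^sup>2"
    using broken_line_reflection[OF n(1)] .
  also have "\<dots> = (dist x z + dist z y)\<^sup>2"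
    by (simp add: dist_norm norm_minus_commute)
  finally have "((dist x y + 2 * m) / sqrt 2)\<^sup>2 \<le> (dist x z + dist z y)\<^sup>2"
    by (simp add: power_divide)
  then show "(dist x y + 2 * m) / sqrt 2 \<le> dist x z + dist z y"
    by (rule power2_le_imp_le) simp
qed

section \<open>Comparison of the balls\<close>

lemma bdry_dist_pos:
  assumes "open G" "G \<noteq> UNIV" "x \<in> G"
  shows "0 < bdry_dist G x"
  using infdist_frontier_pos[OF assms] by (simp add: bdry_dist_def)

lemma distance_ratio_less_ln_iff:
  assumes "open G" "G \<noteq> UNIV" "x \<in> G" "y \<in> G" "0 < c"
  shows "distance_ratio_metric G x y < ln c \<longleftrightarrow>
    dist x y < (c - 1) * min (bdry_dist G x) (bdry_dist G y)"
proof -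
  define m where "m = min (bdry_dist G x) (bdry_dist G y)"
  have m: "0 < m"
    using assms bdry_dist_pos by (auto simp: m_def)
  then have "0 < 1 + dist x y / m"
    by (intro add_pos_nonneg) auto
  then have "distance_ratio_metric G x y < ln c \<longleftrightarrow> 1 + dist x y / m < c"
    using assms(5) by (simp add: distance_ratio_metric_def m_def)
  then show ?thesis
    using m by (simp add: m_def[symmetric] field_simps)
qed

lemma triangular_ratio_less:
  assumes "a \<le> (INF z\<in>frontier G. dist x z + dist z y)" "0 < a" "dist x y < t * a" "0 < t"
  shows "triangular_ratio_metric G x y < t"
proof -
  define L where "L = (INF z\<in>frontier G. dist x z + dist z y)"
  have "0 < L" "t * a \<le> t * L"
    using assms by (auto simp: L_def)
  then show ?thesis
    using assms(3) by (simp add: triangular_ratio_metric_def L_def[symmetric] divide_less_eq)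
qed

lemma j_ball_subset_s_ball:
  assumes "open G" "G \<noteq> UNIV" "x \<in> G" "0 < t"
  shows "j_ball G x (ln (1 + 2 * t)) \<subseteq> s_ball G x t"
proof
  fix y assume "y \<in> j_ball G x (ln (1 + 2 * t))"
  then have y: "y \<in> G" and j: "distance_ratio_metric G x y < ln (1 + 2 * t)"
    by (auto simp: j_ball_def)
  let ?m = "min (bdry_dist G x) (bdry_dist G y)"
  have d: "dist x y < t * (2 * ?m)"
    using j distance_ratio_less_ln_iff[OF assms(1-3) y, of "1 + 2 * t"] assms(4)
    by (simp add: mult_ac)
  have "2 * ?m \<le> (INF z\<in>frontier G. dist x z + dist z y)"
    using INF_broken_lines_ge[OF frontier_nonempty[OF assms(3,2)], of x y]
    by (auto simp: bdry_dist_def)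
  moreover have "0 < 2 * ?m"
    using bdry_dist_pos[OF assms(1,2)] assms(3) y by simp
  ultimately show "y \<in> s_ball G x t"
    using y triangular_ratio_less[OF _ _ d assms(4)] by (simp add: s_ball_def)
qed

lemma s_ball_subset_j_ball:
  assumes "open G" "G \<noteq> UNIV" "x \<in> G" "0 < t" "t < 1"
  shows "s_ball G x t \<subseteq> j_ball G x (ln ((1 + t) / (1 - t)))"
proof
  fix y assume "y \<in> s_ball G x t"
  then have y: "y \<in> G" and s: "triangular_ratio_metric G x y < t"
    by (auto simp: s_ball_def)
  define m where "m = min (bdry_dist G x) (bdry_dist G y)"
  define L where "L = (INF z\<in>frontier G. dist x z + dist z y)"
  have ne: "frontier G \<noteq> {}"
    using frontier_nonempty[OF assms(3,2)] .
  have "0 < bdry_dist G x" "0 < bdry_dist G y"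
    using bdry_dist_pos[OF assms(1,2)] assms(3) y by auto
  then have "0 < L"
    using INF_broken_lines_ge[OF ne, of x y] by (simp add: bdry_dist_def L_def)
  then have "dist x y < t * L"
    using s by (simp add: triangular_ratio_metric_def L_def[symmetric] divide_less_eq)
  also have "\<dots> \<le> t * (dist x y + 2 * m)"
    using INF_broken_lines_le[OF frontier_closed ne, of x y] assms(4)
    by (simp add: L_def m_def bdry_dist_def)
  finally have "dist x y * (1 - t) < 2 * t * m"
    by (simp add: algebra_simps)
  then have "dist x y < ((1 + t) / (1 - t) - 1) * m"
    using assms(5) by (simp add: field_simps)
  then have "distance_ratio_metric G x y < ln ((1 + t) / (1 - t))"
    using distance_ratio_less_ln_iff[OF assms(1-3) y, of "(1 + t) / (1 - t)"] assms(4,5)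
    by (simp add: m_def)
  then show "y \<in> j_ball G x (ln ((1 + t) / (1 - t)))"
    using y by (simp add: j_ball_def)
qed

text \<open>
  The point at the fraction \<open>k\<close> of the way from \<open>x\<close> to a nearest boundary point \<open>z\<close>. The same \<open>z\<close>
  is nearest to it, which makes the lower and the upper bound for broken lines through the
  boundary coincide.
\<close>

lemma point_towards_boundary:
  assumes "open G" "G \<noteq> UNIV" "x \<in> G" "0 \<le> k" "k < 1"
  obtains y where "y \<in> G" "triangular_ratio_metric G x y = k / (2 - k)"
    "distance_ratio_metric G x y = - ln (1 - k)"
proof -
  define D where "D = bdry_dist G x"
  have D: "0 < D"
    using bdry_dist_pos[OF assms(1-3)] by (simp add: D_def)
  have ne: "frontier G \<noteq> {}"
    using frontier_nonempty[OF assms(3,2)] .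
  obtain z where z: "z \<in> frontier G" "dist x z = D"
    using infdist_attains_inf[OF frontier_closed ne, of x] unfolding D_def bdry_dist_def by metis
  define y where "y = x + k *\<^sub>R (z - x)"
  have xy: "dist x y = k * D"
    using z(2) assms(4) by (simp add: y_def dist_norm norm_minus_commute)
  have "z - y = (1 - k) *\<^sub>R (z - x)"
    by (simp add: y_def algebra_simps)
  then have zy: "dist z y = (1 - k) * D"
    using z(2) assms(5) by (simp add: dist_norm norm_minus_commute)
  have "k * D < D"
    using D assms(5) by simp
  then have y: "y \<in> G"
    using ball_infdist_frontier_subset[OF assms(3)] xy unfolding D_def bdry_dist_def by auto
  have "bdry_dist G y \<le> (1 - k) * D"
    using infdist_le[OF z(1), of y] zy by (simp add: bdry_dist_def dist_commute)
  moreover have "D \<le> bdry_dist G y + dist x y"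
    using infdist_triangle[of x "frontier G" y] by (simp add: D_def bdry_dist_def)
  ultimately have dy: "bdry_dist G y = (1 - k) * D"
    using xy by (simp add: algebra_simps)
  have "(INF z\<in>frontier G. dist x z + dist z y) \<le> dist x z + dist z y"
    using bdd_below_broken_lines z(1) by (rule cINF_lower)
  moreover have "D + (1 - k) * D \<le> (INF z\<in>frontier G. dist x z + dist z y)"
    using INF_broken_lines_ge[OF ne, of x y] dy by (simp add: D_def bdry_dist_def)
  ultimately have "(INF z\<in>frontier G. dist x z + dist z y) = (2 - k) * D"
    using z(2) zy by (simp add: algebra_simps)
  then have s: "triangular_ratio_metric G x y = k / (2 - k)"
    using xy D by (simp add: triangular_ratio_metric_def)
  have "(1 - k) * D \<le> D"
    using D assms(4) by (simp add: algebra_simps)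
  then have "min (bdry_dist G x) (bdry_dist G y) = (1 - k) * D"
    using dy by (simp add: D_def[symmetric])
  then have "distance_ratio_metric G x y = ln (1 + k / (1 - k))"
    using xy D by (simp add: distance_ratio_metric_def)
  also have "1 + k / (1 - k) = inverse (1 - k)"
    using assms(5) by (simp add: field_simps)
  also have "ln (inverse (1 - k)) = - ln (1 - k)"
    using assms(5) by (simp add: ln_inverse)
  finally show thesis
    using that y s by blast
qed

lemma s_ball_not_subset_smaller_j_ball:
  assumes "open G" "G \<noteq> UNIV" "x \<in> G" "0 < t" "t < 1" "r < ln ((1 + t) / (1 - t))"
  shows "\<not> s_ball G x t \<subseteq> j_ball G x r"
proof -
  \<comment> \<open>The fraction solving \<open>- ln (1 - k) = r\<close>, or 0, i.e. the centre itself, when \<open>r\<close> is negative.\<close>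
  define k where "k = max 0 (1 - exp (- r))"
  have k: "0 \<le> k" "k < 1"
    by (auto simp: k_def)
  have "ln (1 - k) \<le> ln (exp (- r))"
    using k by (intro ln_mono) (auto simp: k_def)
  then have j: "r \<le> - ln (1 - k)"
    by simp
  have "exp r < (1 + t) / (1 - t)"
    using exp_less_mono[OF assms(6)] assms(4,5) by simp
  then have "(1 - t) / (1 + t) < exp (- r)"
    using assms(4,5) by (simp add: exp_minus field_simps)
  moreover have "1 - (1 - t) / (1 + t) = 2 * t / (1 + t)"
    using assms(4) by (simp add: field_simps)
  ultimately have "k < 2 * t / (1 + t)"
    using assms(4) by (simp add: k_def)
  then have s: "k / (2 - k) < t"
    using k assms(4) by (simp add: field_simps)
  obtain y where "y \<in> G" "triangular_ratio_metric G x y = k / (2 - k)"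
    "distance_ratio_metric G x y = - ln (1 - k)"
    using point_towards_boundary[OF assms(1-3) k] .
  then have "y \<in> s_ball G x t" "y \<notin> j_ball G x r"
    using s j by (auto simp: s_ball_def j_ball_def)
  then show ?thesis
    by blast
qed

lemma convex_j_ball_subset_s_ball:
  assumes "open G" "convex G" "G \<noteq> UNIV" "x \<in> G" "0 < t" "t < sqrt 2"
  shows "j_ball G x (ln ((t + sqrt 2) / (sqrt 2 - t))) \<subseteq> s_ball G x t"
proof
  fix y assume "y \<in> j_ball G x (ln ((t + sqrt 2) / (sqrt 2 - t)))"
  then have y: "y \<in> G"
    and j: "distance_ratio_metric G x y < ln ((t + sqrt 2) / (sqrt 2 - t))"
    by (auto simp: j_ball_def)
  define m where "m = min (bdry_dist G x) (bdry_dist G y)"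
  have m: "0 < m"
    using bdry_dist_pos[OF assms(1,3)] assms(4) y by (simp add: m_def)
  have pos: "0 < (t + sqrt 2) / (sqrt 2 - t)"
    using assms(5,6) by (intro divide_pos_pos add_pos_pos) auto
  have "dist x y < ((t + sqrt 2) / (sqrt 2 - t) - 1) * m"
    using j distance_ratio_less_ln_iff[OF assms(1,3,4) y pos] by (simp add: m_def)
  then have "dist x y * sqrt 2 < t * (dist x y + 2 * m)"
    using assms(6) by (simp add: field_simps)
  then have d: "dist x y < t * ((dist x y + 2 * m) / sqrt 2)"
    by (simp add: less_divide_eq)
  have "0 < (dist x y + 2 * m) / sqrt 2"
    using m by (intro divide_pos_pos add_nonneg_pos) auto
  then show "y \<in> s_ball G x t"
    using y triangular_ratio_less[OF _ _ d assms(5)]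
      convex_INF_broken_lines_ge[OF assms(1-4) y]
    by (simp add: s_ball_def m_def bdry_dist_def)
qed

theorem corollary4p10:
  fixes G :: "(real ^ 'n) set" and x :: "real ^ 'n" and t :: real
  assumes "open G" and "connected G" and "G \<noteq> UNIV"
    and "x \<in> G" and "0 < t" and "t < 1"
  shows "j_ball G x (ln (1 + 2 * t)) \<subseteq> s_ball G x t
    \<and> s_ball G x t \<subseteq> j_ball G x (ln ((1 + t) / (1 - t)))
    \<and> (\<forall>r. r < ln ((1 + t) / (1 - t)) \<longrightarrow> \<not> s_ball G x t \<subseteq> j_ball G x r)
    \<and> (convex G \<longrightarrow>
        j_ball G x (max (ln ((t + sqrt 2) / (sqrt 2 - t))) (ln (1 + 2 * t))) \<subseteq> s_ball G x t)"
proof (intro conjI allI impI)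
  show inner: "j_ball G x (ln (1 + 2 * t)) \<subseteq> s_ball G x t"
    using j_ball_subset_s_ball[OF assms(1,3,4,5)] .
  show "s_ball G x t \<subseteq> j_ball G x (ln ((1 + t) / (1 - t)))"
    using s_ball_subset_j_ball[OF assms(1,3-6)] .
  show "\<not> s_ball G x t \<subseteq> j_ball G x r" if "r < ln ((1 + t) / (1 - t))" for r
    using s_ball_not_subset_smaller_j_ball[OF assms(1,3-6) that] .
  assume "convex G"
  moreover have "t < sqrt 2"
    using assms(6) by (rule less_trans) simp
  ultimately have "j_ball G x (ln ((t + sqrt 2) / (sqrt 2 - t))) \<subseteq> s_ball G x t"
    using convex_j_ball_subset_s_ball assms by blast
  then show "j_ball G x (max (ln ((t + sqrt 2) / (sqrt 2 - t))) (ln (1 + 2 * t))) \<subseteq> s_ball G x t"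
    using inner by (simp add: max_def)
qed

end
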